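(* For all integers $m \geq n \geq 8$, $DD_{\mathrm{m}}(P_m \,\square\, P_n) \leq \left\lfloor \frac{(n+2)(m+3)}{5}\right\rfloor$.
   Context: $P_k$ is the path on $k$ vertices. $G\,\square\,H$ denotes the Cartesian product: vertex set $V(G)\times V(H)$, with $(a,b)$ and $(c,d)$ adjacent iff $a=c$ and $bd\in E(H)$, or $ac\in E(G)$ and $b=d$; thus $P_m\,\square\,P_n$ is the $m\times n$ grid graph. Swap number: a dominating set $D$ of a graph $G$ is a swap set if there is a dominating set $D'$ of $G$ with $D\cap D'=\emptyset$, $|D|=|D'|$, such that $G$ contains a perfect matching between $D$ and $D'$ (a bijection $f:D\to D'$ with $x f(x)\in E(G)$ for all $x\in D$). $DD_{\mathrm{m}}(G)$ is the minimum cardinality of a swap set of $G$, and $DD_{\mathrm{m}}(G)=\infty$ if none exists. *)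

theory Defs
  imports Complex_Main "HOL-Library.Extended_Nat" "Graph_Theory.Pair_Digraph"
begin

text \<open>
  Undirected simple graphs are loop-free symmetric digraphs (locale \<^locale>\<open>pair_graph\<close>):
  an edge \<open>xy\<close> is represented by the two arcs \<open>(x, y)\<close> and \<open>(y, x)\<close>.
\<close>

definition path_graph :: "nat \<Rightarrow> nat pair_pre_digraph" where
  "path_graph k =
     \<lparr> pverts = {0..<k},
       parcs = {(i, j). i < k \<and> j < k \<and> (j = Suc i \<or> i = Suc j)} \<rparr>"

definition cartesian_product ::
    "'a pair_pre_digraph \<Rightarrow> 'b pair_pre_digraph \<Rightarrow> ('a \<times> 'b) pair_pre_digraph"
    (infixr \<open>\<box>\<close> 80) where
  "G \<box> H =
     \<lparr> pverts = pverts G \<times> pverts H,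
       parcs = {((a, b), (c, d)) | a b c d.
                  (a \<in> pverts G \<and> a = c \<and> (b, d) \<in> parcs H) \<or>
                  ((a, c) \<in> parcs G \<and> b \<in> pverts H \<and> b = d)} \<rparr>"

definition dominating_set :: "'a pair_pre_digraph \<Rightarrow> 'a set \<Rightarrow> bool" where
  "dominating_set G D \<longleftrightarrow>
     D \<subseteq> pverts G \<and> (\<forall>v \<in> pverts G - D. \<exists>u \<in> D. (u, v) \<in> parcs G)"

definition swap_set :: "'a pair_pre_digraph \<Rightarrow> 'a set \<Rightarrow> bool" where
  "swap_set G D \<longleftrightarrow>
     dominating_set G D \<and>
     (\<exists>D'. dominating_set G D' \<and> D \<inter> D' = {} \<and> card D = card D' \<and>
           (\<exists>f. bij_betw f D D' \<and> (\<forall>x \<in> D. (x, f x) \<in> parcs G)))"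

text \<open>
  Infima in \<^typ>\<open>enat\<close> are attained for nonempty sets, and the infimum of the empty set is
  \<open>\<infinity>\<close>. The definition is meant for finite graphs only, since \<^const>\<open>card\<close> is \<open>0\<close> on infinite sets.
\<close>

definition DD\<^sub>m :: "'a pair_pre_digraph \<Rightarrow> enat" where
  "DD\<^sub>m G = (INF D \<in> {D. swap_set G D}. enat (card D))"

lemma pair_graph_path_graph: "pair_graph (path_graph k)"
proof
  have "parcs (path_graph k) \<subseteq> {0..<k} \<times> {0..<k}"
    by (auto simp: path_graph_def)
  then show "finite (parcs (path_graph k))"
    by (rule finite_subset) simp
qed (auto simp: path_graph_def symmetric_def intro!: symI)

lemma pair_graph_cartesian_product:
  assumes "pair_graph G" "pair_graph H"
  shows "pair_graph (G \<box> H)"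
proof -
  interpret G: pair_graph G by fact
  interpret H: pair_graph H by fact
  have G: "a \<in> pverts G \<and> c \<in> pverts G \<and> a \<noteq> c \<and> (c, a) \<in> parcs G" if "(a, c) \<in> parcs G" for a c
    using that G.arcs_symmetric by (auto dest: G.in_arcsD1 G.in_arcsD2 G.no_loops')
  have H: "b \<in> pverts H \<and> d \<in> pverts H \<and> b \<noteq> d \<and> (d, b) \<in> parcs H" if "(b, d) \<in> parcs H" for b d
    using that H.arcs_symmetric by (auto dest: H.in_arcsD1 H.in_arcsD2 H.no_loops')
  show ?thesis
  proof
    have "parcs (G \<box> H) \<subseteq> (pverts G \<times> pverts H) \<times> (pverts G \<times> pverts H)"
      by (auto simp: cartesian_product_def dest: G H)
    then show "finite (parcs (G \<box> H))"
      by (rule finite_subset) simp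
  qed (auto simp: cartesian_product_def symmetric_def intro!: symI dest: G H)
qed

end

theory Submission
  imports Defs
begin

text \<open>
  Number the columns of the grid \<open>1, \<dots>, m\<close> and the rows \<open>1, \<dots>, n\<close>. The perfect code
  \<open>x + 2 y \<equiv> c (mod 5)\<close> of the infinite grid and its translate by one column are disjoint, both
  dominate, and are matched by horizontal dominoes \<open>{(x, y), (x + 1, y)}\<close>. Only dominoes with
  left end in \<open>{-1, \<dots>, m + 1} \<times> {0, \<dots>, n + 1}\<close> can matter for the finite grid, and by averaging
  over \<open>c\<close> at most \<open>(m + 3) (n + 2) / 5\<close> of these occur. Every domino that sticks out is pushed
  into the grid or dropped: those in rows \<open>0\<close> and \<open>n + 1\<close> go to rows \<open>1\<close> and \<open>n\<close>, those
  crossing the left or right border go to the two outermost columns, reversed if necessary so that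
  the end closer to the grid lands in the outermost column, and the few clashes in the corners are
  resolved individually.
  A rotation of the grid by \<open>180\<close> degrees exchanges the two families of domino ends, up to a
  change of \<open>c\<close>; so only one of them has to be described and shown to dominate.
\<close>

section \<open>Row patterns modulo 5: domination, matching, disjointness\<close>

text \<open>
  In row \<open>y\<close> of the code the left ends satisfy \<open>x \<equiv> r\<close> for \<open>r = c - 2 y\<close>. The first and last
  rows contain in addition the dominoes pushed in from the row outside the grid; their parameters
  \<open>s\<close> and \<open>t\<close> are the residues of that outer row.
\<close>

definition mid_row :: "int \<Rightarrow> int \<Rightarrow> int \<Rightarrow> bool" where
  "mid_row m r x \<longleftrightarrow>
     5 dvd x - r \<or> (x = 2 \<and> (5 dvd r \<or> 5 dvd r + 1)) \<or> (x = m \<and> 5 dvd m + 1 - r)"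

definition bottom_row :: "int \<Rightarrow> int \<Rightarrow> int \<Rightarrow> bool" where
  "bottom_row m s x \<longleftrightarrow>
     (5 dvd x - s \<or> 5 dvd x - s + 2 \<or> (x = 2 \<and> 5 dvd s) \<or> (x = 4 \<and> 5 dvd s - 2) \<or>
      (x = m - 1 \<and> 5 dvd m - 2 - s)) \<and>
     \<not> (x = m - 2 \<and> 5 dvd m - 2 - s) \<and> \<not> (x = m \<and> 5 dvd m - s)"

definition top_row :: "int \<Rightarrow> int \<Rightarrow> int \<Rightarrow> bool" where
  "top_row m t x \<longleftrightarrow>
     (5 dvd x - t \<or> 5 dvd x - t - 2 \<or> (x = 2 \<and> 5 dvd t - 3) \<or> (x = 1 \<and> 5 dvd t - 2)) \<and>
     \<not> (x = 2 \<and> 5 dvd t - 2)"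

text \<open>The cells whose domino got reversed, so that their partner is to the left.\<close>

definition mid_left :: "int \<Rightarrow> int \<Rightarrow> int \<Rightarrow> bool" where
  "mid_left m r x \<longleftrightarrow> (x = 2 \<and> (5 dvd r \<or> 5 dvd r + 1)) \<or> x = m"

definition bottom_left :: "int \<Rightarrow> int \<Rightarrow> int \<Rightarrow> bool" where
  "bottom_left m s x \<longleftrightarrow> (x = 2 \<and> 5 dvd s) \<or> ((x = 2 \<or> x = 4) \<and> 5 dvd s - 2) \<or> x = m"

definition top_left :: "int \<Rightarrow> int \<Rightarrow> int \<Rightarrow> bool" where
  "top_left m t x \<longleftrightarrow>
     (x = m \<and> 5 dvd m - t) \<or> ((x = m \<or> x = m - 2) \<and> 5 dvd m - 2 - t) \<or> (x = 2 \<and> 5 dvd t - 3)"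

text \<open>
  Away from the four outermost columns on either side all conditions below depend on \<open>x - r\<close>
  modulo \<open>5\<close> only; in those columns they depend on \<open>r\<close> or on \<open>m - r\<close> modulo \<open>5\<close>.
\<close>

lemma column_cases:
  fixes m x :: int
  assumes "8 \<le> m" "1 \<le> x" "x \<le> m"
  obtains "x = 1" | "x = 2" | "x = 3" | "x = 4" | "x = m" | "x = m - 1" | "x = m - 2" | "x = m - 3"
    | "5 \<le> x" "x \<le> m - 4"
  using assms by linarith

text \<open>A cell and its four neighbours in the infinite grid cover all residues modulo 5; the
  rows below and above have residues \<open>r + 2\<close> and \<open>r - 2\<close>. In column
  \<open>1\<close> the missing left neighbour is replaced by the pushed-in cell \<open>2\<close>, in
  column \<open>m\<close> the right one by \<open>m\<close> itself. Only code cells of the adjacent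
  rows occur, since such a row may be the first or the last.\<close>

lemma mid_row_dominates:
  assumes "8 \<le> m" "1 \<le> x" "x \<le> m"
  shows "mid_row m r x \<or> (1 < x \<and> mid_row m r (x - 1)) \<or> (x < m \<and> mid_row m r (x + 1)) \<or>
    5 dvd x - (r - 2) \<or> 5 dvd x - (r + 2)"
  using assms by (rule column_cases; use \<open>8 \<le> m\<close> in \<open>simp add: mid_row_def\<close>; presburger)

text \<open>Row \<open>0\<close> is missing, but its code cells now lie in row \<open>1\<close>.
  Pushed-in cells of row \<open>2\<close> matter: if \<open>m\<close> and \<open>s\<close> are
  congruent, the domino at \<open>(m, 0)\<close> is dropped and the corner \<open>(m, 1)\<close> is
  dominated by \<open>(m, 2)\<close>, pushed in from \<open>(m + 1, 2)\<close>.\<close>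

lemma bottom_row_dominates:
  assumes "8 \<le> m" "1 \<le> x" "x \<le> m"
  shows "bottom_row m s x \<or> (1 < x \<and> bottom_row m s (x - 1)) \<or> (x < m \<and> bottom_row m s (x + 1)) \<or>
    mid_row m (s - 4) x"
  using assms
  by (rule column_cases; use \<open>8 \<le> m\<close> in \<open>simp add: bottom_row_def mid_row_def\<close>; presburger)

lemma top_row_dominates:
  assumes "8 \<le> m" "1 \<le> x" "x \<le> m"
  shows "top_row m t x \<or> (1 < x \<and> top_row m t (x - 1)) \<or> (x < m \<and> top_row m t (x + 1)) \<or>
    mid_row m (t + 4) x"
  using assms
  by (rule column_cases; use \<open>8 \<le> m\<close> in \<open>simp add: top_row_def mid_row_def\<close>; presburger)

definition hop :: "bool \<Rightarrow> int \<Rightarrow> int" where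
  "hop b x = (if b then x - 1 else x + 1)"

text \<open>The equality of flags makes the matching invertible: rotation exchanges left and right,
  so the same hop in rotated coordinates leads back to \<open>x\<close>.\<close>

lemma mid_row_partner:
  assumes "8 \<le> m" "1 \<le> x" "x \<le> m" "mid_row m r x"
  defines "x' \<equiv> hop (mid_left m r x) x"
  shows "1 \<le> x'" "x' \<le> m" "mid_row m (m - r) (m + 1 - x')"
    "mid_left m (m - r) (m + 1 - x') = mid_left m r x"
  unfolding x'_def using assms(1-3)
  by (rule column_cases; use assms(1,4) in \<open>simp add: mid_row_def mid_left_def hop_def\<close>; presburger)+

lemma bottom_row_partner:
  assumes "8 \<le> m" "1 \<le> x" "x \<le> m" "bottom_row m s x"
  defines "x' \<equiv> hop (bottom_left m s x) x"
  shows "1 \<le> x'" "x' \<le> m" "top_row m (m - s) (m + 1 - x')"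
    "top_left m (m - s) (m + 1 - x') = bottom_left m s x"
  unfolding x'_def using assms(1-3)
  by (rule column_cases; use assms(1,4) in
      \<open>simp add: bottom_row_def top_row_def bottom_left_def top_left_def hop_def\<close>; presburger)+

lemma top_row_partner:
  assumes "8 \<le> m" "1 \<le> x" "x \<le> m" "top_row m t x"
  defines "x' \<equiv> hop (top_left m t x) x"
  shows "1 \<le> x'" "x' \<le> m" "bottom_row m (m - t) (m + 1 - x')"
    "bottom_left m (m - t) (m + 1 - x') = top_left m t x"
  unfolding x'_def using assms(1-3)
  by (rule column_cases; use assms(1,4) in
      \<open>simp add: bottom_row_def top_row_def bottom_left_def top_left_def hop_def\<close>; presburger)+

lemma mid_row_disjoint:
  assumes "8 \<le> m" "1 \<le> x" "x \<le> m" "mid_row m r x"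
  shows "\<not> mid_row m (m - r) (m + 1 - x)"
  using assms(1-3)
  by (rule column_cases; use assms(1,4) in \<open>simp add: mid_row_def\<close>; presburger)

lemma bottom_row_disjoint_top_row:
  assumes "8 \<le> m" "1 \<le> x" "x \<le> m" "bottom_row m s x"
  shows "\<not> top_row m (m - s) (m + 1 - x)"
  using assms(1-3)
  by (rule column_cases; use assms(1,4) in \<open>simp add: bottom_row_def top_row_def\<close>; presburger)

lemma top_row_disjoint_bottom_row:
  assumes "8 \<le> m" "1 \<le> x" "x \<le> m" "top_row m t x"
  shows "\<not> bottom_row m (m - t) (m + 1 - x)"
  using assms(1-3)
  by (rule column_cases; use assms(1,4) in \<open>simp add: bottom_row_def top_row_def\<close>; presburger)

section \<open>Assembling the rows; rotation by 180 degrees\<close>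

definition cell :: "int \<Rightarrow> int \<Rightarrow> int \<Rightarrow> int \<Rightarrow> int \<Rightarrow> bool" where
  "cell m n c x y =
     (if y = 1 then bottom_row m c x
      else if y = n then top_row m (c - 2 * (n + 1)) x
      else mid_row m (c - 2 * y) x)"

definition moves_left :: "int \<Rightarrow> int \<Rightarrow> int \<Rightarrow> int \<Rightarrow> int \<Rightarrow> bool" where
  "moves_left m n c x y =
     (if y = 1 then bottom_left m c x
      else if y = n then top_left m (c - 2 * (n + 1)) x
      else mid_left m (c - 2 * y) x)"

text \<open>
  The parameter of the rotated code: a domino with left end \<open>(x, y)\<close> is rotated to one with left
  end \<open>(m - x, n + 1 - y)\<close>.
\<close>

definition opposite :: "int \<Rightarrow> int \<Rightarrow> int \<Rightarrow> int" where
  "opposite m n c = m + 2 * (n + 1) - c"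

lemma opposite_opposite [simp]: "opposite m n (opposite m n c) = c"
  by (simp add: opposite_def)

text \<open>Row residues turn from \<open>r\<close> into \<open>m - r\<close>, as
  \<open>opposite m n c - 2 * (n + 1 - y) = m - (c - 2 * y)\<close>, while the first and last rows
  trade places.\<close>

lemma cell_rotated:
  assumes "8 \<le> n"
  shows "cell m n (opposite m n c) x (n + 1 - y) =
    (if y = 1 then top_row m (m - c) x
     else if y = n then bottom_row m (m - (c - 2 * (n + 1))) x
     else mid_row m (m - (c - 2 * y)) x)"
  using assms by (auto simp: cell_def opposite_def algebra_simps)

lemma moves_left_rotated:
  assumes "8 \<le> n"
  shows "moves_left m n (opposite m n c) x (n + 1 - y) =
    (if y = 1 then top_left m (m - c) x
     else if y = n then bottom_left m (m - (c - 2 * (n + 1))) x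
     else mid_left m (m - (c - 2 * y)) x)"
  using assms by (auto simp: moves_left_def opposite_def algebra_simps)

lemma cell_partner:
  assumes "8 \<le> m" "8 \<le> n" "1 \<le> x" "x \<le> m" "cell m n c x y"
  defines "x' \<equiv> hop (moves_left m n c x y) x"
  shows "1 \<le> x'" "x' \<le> m" "cell m n (opposite m n c) (m + 1 - x') (n + 1 - y)"
    "moves_left m n (opposite m n c) (m + 1 - x') (n + 1 - y) = moves_left m n c x y"
  using mid_row_partner[OF assms(1,3,4), of "c - 2 * y"]
    bottom_row_partner[OF assms(1,3,4), of c]
    top_row_partner[OF assms(1,3,4), of "c - 2 * (n + 1)"] assms(5)
  unfolding x'_def cell_rotated[OF assms(2)] moves_left_rotated[OF assms(2)]
  unfolding cell_def moves_left_def
  by (simp_all split: if_splits)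

lemma cell_disjoint_rotated:
  assumes "8 \<le> m" "8 \<le> n" "1 \<le> x" "x \<le> m" "cell m n c x y"
  shows "\<not> cell m n (opposite m n c) (m + 1 - x) (n + 1 - y)"
  using mid_row_disjoint[OF assms(1,3,4), of "c - 2 * y"]
    bottom_row_disjoint_top_row[OF assms(1,3,4), of c]
    top_row_disjoint_bottom_row[OF assms(1,3,4), of "c - 2 * (n + 1)"] assms(5)
  unfolding cell_rotated[OF assms(2)] unfolding cell_def
  by (auto split: if_splits)

text \<open>The exclusions in \<open>bottom_row\<close> and \<open>top_row\<close> hit only cells
  congruent to the residue of the outer row, hence never a code cell of the row itself.\<close>

lemma cell_perfect_code:
  assumes "5 dvd x + 2 * y - c"
  shows "cell m n c x y"
proof -
  consider "y = 1" | "y = n" "y \<noteq> 1" | "y \<noteq> 1" "y \<noteq> n" by blast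
  then show ?thesis
  proof cases
    case 1
    then have "5 dvd x - c + 2" using assms by (simp add: algebra_simps)
    then show ?thesis using 1 unfolding cell_def bottom_row_def by simp presburger
  next
    case 2
    define t where "t = c - 2 * (n + 1)"
    have eq: "x + 2 * y - c = x - t - 2" using 2 by (simp add: t_def)
    have "5 dvd x - t - 2" using assms unfolding eq .
    then have "top_row m t x" unfolding top_row_def by presburger
    then show ?thesis using 2 by (simp add: cell_def t_def)
  next
    case 3
    have eq: "x + 2 * y - c = x - (c - 2 * y)" by simp
    show ?thesis using 3 assms unfolding eq by (simp add: cell_def mid_row_def)
  qed
qed

lemma cell_dominates:
  assumes "8 \<le> m" "8 \<le> n" "1 \<le> x" "x \<le> m" "1 \<le> y" "y \<le> n"
  shows "cell m n c x y \<or> (1 < x \<and> cell m n c (x - 1) y) \<or> (x < m \<and> cell m n c (x + 1) y) \<or>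
    (1 < y \<and> cell m n c x (y - 1)) \<or> (y < n \<and> cell m n c x (y + 1))"
proof -
  consider "y = 1" | "y = n" | "1 < y" "y < n" using assms by linarith
  then show ?thesis
  proof cases
    case 1
    have "cell m n c x (y + 1) = mid_row m (c - 4) x" using 1 assms(2) by (simp add: cell_def)
    then show ?thesis
      using bottom_row_dominates[OF assms(1,3,4), of c] 1 assms(2) by (auto simp: cell_def)
  next
    case 2
    have "cell m n c x (y - 1) = mid_row m (c - 2 * (n + 1) + 4) x"
      using 2 assms(2) by (simp add: cell_def algebra_simps)
    then show ?thesis
      using top_row_dominates[OF assms(1,3,4), of "c - 2 * (n + 1)"] 2 assms(2)
      by (auto simp: cell_def)
  next
    case 3
    have "cell m n c x (y - 1)" if "5 dvd x - (c - 2 * y + 2)"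
      using that assms by (intro cell_perfect_code) (auto simp: algebra_simps)
    moreover have "cell m n c x (y + 1)" if "5 dvd x - (c - 2 * y - 2)"
      using that assms by (intro cell_perfect_code) (auto simp: algebra_simps)
    ultimately show ?thesis
      using mid_row_dominates[OF assms(1,3,4), of "c - 2 * y"] 3 by (auto simp: cell_def)
  qed
qed

section \<open>Counting cells by code points\<close>

definition perfect_code :: "int \<Rightarrow> int \<Rightarrow> int \<Rightarrow> (int \<times> int) set" where
  "perfect_code m n c = {(x, y) \<in> {-1..m + 1} \<times> {0..n + 1}. 5 dvd x + 2 * y - c}"

text \<open>
  Sends the left end of each domino to its final place. Dropped dominoes get an arbitrary value,
  possibly outside the grid.
\<close>

definition project :: "int \<Rightarrow> int \<Rightarrow> int \<times> int \<Rightarrow> int \<times> int" where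
  "project m n = (\<lambda>(x, y).
     if y = 0 then (if x \<le> 0 then 2 else if x = 2 then 4 else if x = m - 2 then m - 1 else x, 1)
     else if y = n + 1 then (if x = 2 then 1 else x, n)
     else (if x \<le> 0 then 2 else if x > m then m else x, y))"

lemma finite_perfect_code: "finite (perfect_code m n c)"
  unfolding perfect_code_def by (rule finite_subset[of _ "{-1..m + 1} \<times> {0..n + 1}"]) auto

lemma cell_in_project:
  assumes "8 \<le> m" "8 \<le> n" "1 \<le> x" "x \<le> m" "1 \<le> y" "y \<le> n" "cell m n c x y"
  shows "(x, y) \<in> project m n ` perfect_code m n c"
proof -
  have origin: "(x, y) \<in> project m n ` perfect_code m n c"
    if "project m n (u, v) = (x, y)" "-1 \<le> u" "u \<le> m + 1" "0 \<le> v" "v \<le> n + 1"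
      "5 dvd u + 2 * v - c" for u v
    by (rule image_eqI[of _ _ "(u, v)"]) (use that in \<open>auto simp: perfect_code_def\<close>)
  consider "y = 1" | "y = n" | "1 < y" "y < n" using assms by linarith
  then show ?thesis
  proof cases
    case 1
    then have "bottom_row m c x" using assms by (simp add: cell_def)
    then consider "5 dvd x - c + 2" | "x \<noteq> 2" "x \<noteq> m - 2" "5 dvd x - c" | "x = 2" "5 dvd c"
      | "x = 2" "5 dvd x - c" | "x = 4" "5 dvd c - 2" | "x = m - 1" "5 dvd m - 2 - c"
      unfolding bottom_row_def by auto
    then show ?thesis
    proof cases
      case 1
      then have "5 dvd x + 2 * 1 - c" by (simp add: algebra_simps)
      then show ?thesis using \<open>y = 1\<close> assms by (intro origin[of x 1]) (auto simp: project_def)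
    next
      case 2 then show ?thesis using \<open>y = 1\<close> assms by (intro origin[of x 0]) (auto simp: project_def)
    next
      case 3 then show ?thesis using \<open>y = 1\<close> assms by (intro origin[of 0 0]) (auto simp: project_def)
    next
      \<comment> \<open>A corner clash: \<open>(0, 1)\<close> and \<open>(2, 0)\<close> both aim at
        \<open>(2, 1)\<close>. The domino crossing the left border gets it; the other moves to
        column \<open>4\<close>.\<close>
      case 4 then show ?thesis using \<open>y = 1\<close> assms
        by (intro origin[of 0 1]) (auto simp: project_def dvd_diff_commute)
    next
      case 5 then show ?thesis using \<open>y = 1\<close> assms
        by (intro origin[of 2 0]) (auto simp: project_def dvd_diff_commute)
    next
      case 6 then show ?thesis using \<open>y = 1\<close> assms
        by (intro origin[of "m - 2" 0]) (auto simp: project_def)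
    qed
  next
    case 2
    define t where "t = c - 2 * (n + 1)"
    have c: "c = t + 2 * (n + 1)" by (simp add: t_def)
    have "top_row m t x" using 2 assms by (simp add: cell_def t_def)
    then consider "5 dvd x - t - 2" | "x \<noteq> 2" "5 dvd x - t" | "x = 2" "5 dvd t - 3"
      | "x = 1" "5 dvd t - 2"
      unfolding top_row_def by (auto simp: algebra_simps dvd_diff_commute)
    then show ?thesis
    proof cases
      case 1 then show ?thesis using \<open>y = n\<close> assms
        by (intro origin[of x n]) (auto simp: project_def c algebra_simps)
    next
      case 2 then show ?thesis using \<open>y = n\<close> assms
        by (intro origin[of x "n + 1"]) (auto simp: project_def c algebra_simps)
    next
      case 3
      then have "5 dvd 0 + 2 * n - c" unfolding c by (simp add: algebra_simps) presburger
      then show ?thesis using 3 \<open>y = n\<close> assms by (intro origin[of 0 n]) (auto simp: project_def)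
    next
      case 4
      then have "5 dvd 2 + 2 * (n + 1) - c" unfolding c by (simp add: algebra_simps) presburger
      then show ?thesis using 4 \<open>y = n\<close> assms
        by (intro origin[of 2 "n + 1"]) (auto simp: project_def)
    qed
  next
    case 3
    define r where "r = c - 2 * y"
    have c: "c = r + 2 * y" by (simp add: r_def)
    have "mid_row m r x" using 3 assms by (simp add: cell_def r_def)
    then consider "5 dvd x - r" | "x = 2" "5 dvd r" | "x = 2" "5 dvd r + 1"
      | "x = m" "5 dvd m + 1 - r"
      unfolding mid_row_def by blast
    then show ?thesis
    proof cases
      case 1 then show ?thesis using \<open>1 < y\<close> \<open>y < n\<close> assms
        by (intro origin[of x y]) (auto simp: project_def c)
    next
      case 2 then show ?thesis using \<open>1 < y\<close> \<open>y < n\<close> assms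
        by (intro origin[of 0 y]) (auto simp: project_def c)
    next
      case 3
      then have "5 dvd -1 + 2 * y - c" unfolding c by (simp add: dvd_diff_commute)
      then show ?thesis using 3 \<open>1 < y\<close> \<open>y < n\<close> assms
        by (intro origin[of "-1" y]) (auto simp: project_def)
    next
      case 4 then show ?thesis using \<open>1 < y\<close> \<open>y < n\<close> assms
        by (intro origin[of "m + 1" y]) (auto simp: project_def c)
    qed
  qed
qed

lemma exists_small_perfect_code:
  fixes m n :: nat
  obtains c where "5 * card (perfect_code (int m) (int n) c) \<le> (n + 2) * (m + 3)"
proof -
  let ?S = "\<lambda>c. perfect_code (int m) (int n) c"
  let ?R = "{-1..int m + 1} \<times> {0..int n + 1}"
  have "?R = (\<Union>c\<in>{0..<5}. ?S c)"
  proof -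
    have "\<exists>c\<in>{0..<5}. 5 dvd x + 2 * y - c" for x y :: int
      by (rule bexI[of _ "(x + 2 * y) mod 5"]) auto
    then show ?thesis by (fastforce simp: perfect_code_def)
  qed
  moreover have "card (\<Union>c\<in>{0..<5}. ?S c) = (\<Sum>c\<in>{0..<5}. card (?S c))"
  proof (rule card_UN_disjoint)
    have "c = d" if "c \<in> {0..<5}" "d \<in> {0..<5}" "5 dvd z - c" "5 dvd z - d" for c d z :: int
      using that by simp presburger
    then show "\<forall>c\<in>{0..<5}. \<forall>d\<in>{0..<5}. c \<noteq> d \<longrightarrow> ?S c \<inter> ?S d = {}"
      by (fastforce simp: perfect_code_def)
  qed (simp_all add: finite_perfect_code)
  moreover have "card ?R = (n + 2) * (m + 3)"
    by (simp add: card_cartesian_product nat_add_distrib algebra_simps)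
  ultimately have sum: "(\<Sum>c\<in>{0..<5::int}. card (?S c)) = (n + 2) * (m + 3)" by simp
  have "\<exists>c. 5 * card (?S c) \<le> (n + 2) * (m + 3)"
  proof (rule ccontr)
    assume "\<not> ?thesis"
    then have "(\<Sum>c\<in>{0..<5::int}. (n + 2) * (m + 3)) < (\<Sum>c\<in>{0..<5}. 5 * card (?S c))"
      by (intro sum_strict_mono) (auto simp: not_le)
    then show False using sum by (simp flip: sum_distrib_left)
  qed
  then show thesis using that by blast
qed

section \<open>Domination in the grid graph\<close>

lemma grid_verts: "pverts (path_graph m \<box> path_graph n) = {..<m} \<times> {..<n}"
  by (auto simp: cartesian_product_def path_graph_def)

lemma grid_arc_iff:
  "((a, b), (c, d)) \<in> parcs (path_graph m \<box> path_graph n) \<longleftrightarrow>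
     a < m \<and> b < n \<and> c < m \<and> d < n \<and>
     ((a = c \<and> (d = Suc b \<or> b = Suc d)) \<or> (b = d \<and> (c = Suc a \<or> a = Suc c)))"
  by (auto simp: cartesian_product_def path_graph_def)

lemma DD\<^sub>m_le_card: "swap_set G D \<Longrightarrow> DD\<^sub>m G \<le> enat (card D)"
  unfolding DD\<^sub>m_def by (rule INF_lower) simp

lemma dominating_set_gridI:
  assumes "\<And>i j. i < m \<Longrightarrow> j < n \<Longrightarrow>
    P i j \<or> (0 < i \<and> P (i - 1) j) \<or> (i + 1 < m \<and> P (i + 1) j) \<or>
    (0 < j \<and> P i (j - 1)) \<or> (j + 1 < n \<and> P i (j + 1))"
  shows "dominating_set (path_graph m \<box> path_graph n) {(i, j). i < m \<and> j < n \<and> P i j}"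
  unfolding dominating_set_def
proof (intro conjI ballI)
  fix v assume "v \<in> pverts (path_graph m \<box> path_graph n) - {(i, j). i < m \<and> j < n \<and> P i j}"
  then obtain i j where v: "v = (i, j)" "i < m" "j < n" "\<not> P i j" by (auto simp: grid_verts)
  then consider "0 < i" "P (i - 1) j" | "i + 1 < m" "P (i + 1) j"
    | "0 < j" "P i (j - 1)" | "j + 1 < n" "P i (j + 1)"
    using assms[of i j] by blast
  then show "\<exists>u\<in>{(i, j). i < m \<and> j < n \<and> P i j}. (u, v) \<in> parcs (path_graph m \<box> path_graph n)"
  proof cases
    case 1 with v show ?thesis by (intro bexI[of _ "(i - 1, j)"]) (auto simp: grid_arc_iff)
  next
    case 2 with v show ?thesis by (intro bexI[of _ "(i + 1, j)"]) (auto simp: grid_arc_iff)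
  next
    case 3 with v show ?thesis by (intro bexI[of _ "(i, j - 1)"]) (auto simp: grid_arc_iff)
  next
    case 4 with v show ?thesis by (intro bexI[of _ "(i, j + 1)"]) (auto simp: grid_arc_iff)
  qed
qed (auto simp: grid_verts)

section \<open>The swap set and its matching, with indices from 0\<close>

context
  fixes m n :: nat and c :: int
  assumes m: "8 \<le> m" and n: "8 \<le> n"
begin

definition swap_cells :: "(nat \<times> nat) set" where
  "swap_cells = {(i, j). i < m \<and> j < n \<and> cell m n c (int i + 1) (int j + 1)}"

text \<open>Index \<open>i\<close> means column \<open>i + 1\<close>, which rotates to
  \<open>m + 1 - (i + 1) = m - i\<close>; rows likewise.\<close>

definition swapped_cells :: "(nat \<times> nat) set" where
  "swapped_cells =
     {(i, j). i < m \<and> j < n \<and> cell m n (opposite m n c) (int m - int i) (int n - int j)}"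

definition partner :: "nat \<times> nat \<Rightarrow> nat \<times> nat" where
  "partner = (\<lambda>(i, j).
     (nat (hop (moves_left m n c (int i + 1) (int j + 1)) (int i + 1) - 1), j))"

definition partner_back :: "nat \<times> nat \<Rightarrow> nat \<times> nat" where
  "partner_back = (\<lambda>(i, j).
     (nat (int m - hop (moves_left m n (opposite m n c) (int m - int i) (int n - int j))
                        (int m - int i)), j))"

lemma dominating_set_swap_cells: "dominating_set (path_graph m \<box> path_graph n) swap_cells"
  unfolding swap_cells_def
proof (rule dominating_set_gridI)
  fix i j assume "i < m" "j < n"
  then show "cell m n c (int i + 1) (int j + 1) \<or>
    0 < i \<and> cell m n c (int (i - 1) + 1) (int j + 1) \<or>
    i + 1 < m \<and> cell m n c (int (i + 1) + 1) (int j + 1) \<or>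
    0 < j \<and> cell m n c (int i + 1) (int (j - 1) + 1) \<or>
    j + 1 < n \<and> cell m n c (int i + 1) (int (j + 1) + 1)"
    using cell_dominates[of "int m" "int n" "int i + 1" "int j + 1" c] m n
    by (auto simp: algebra_simps)
qed

lemma dominating_set_swapped_cells: "dominating_set (path_graph m \<box> path_graph n) swapped_cells"
  unfolding swapped_cells_def
proof (rule dominating_set_gridI)
  fix i j assume "i < m" "j < n"
  let ?c = "opposite (int m) (int n) c"
  show "cell m n ?c (int m - int i) (int n - int j) \<or>
    0 < i \<and> cell m n ?c (int m - int (i - 1)) (int n - int j) \<or>
    i + 1 < m \<and> cell m n ?c (int m - int (i + 1)) (int n - int j) \<or>
    0 < j \<and> cell m n ?c (int m - int i) (int n - int (j - 1)) \<or>
    j + 1 < n \<and> cell m n ?c (int m - int i) (int n - int (j + 1))"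
    using cell_dominates[of "int m" "int n" "int m - int i" "int n - int j" ?c] m n \<open>i < m\<close> \<open>j < n\<close>
    by (auto simp: algebra_simps)
qed

lemma swap_cells_disjoint: "swap_cells \<inter> swapped_cells = {}"
proof -
  have "\<not> cell m n (opposite m n c) (int m - int i) (int n - int j)"
    if "i < m" "cell m n c (int i + 1) (int j + 1)" for i j
    using cell_disjoint_rotated[of "int m" "int n" "int i + 1" c "int j + 1"] m n that by simp
  then show ?thesis by (auto simp: swap_cells_def swapped_cells_def)
qed

lemma partner_props:
  assumes "v \<in> swap_cells"
  shows "partner v \<in> swapped_cells" "partner_back (partner v) = v"
    "(v, partner v) \<in> parcs (path_graph m \<box> path_graph n)"
proof -
  obtain i j where v: "v = (i, j)" "i < m" "j < n" "cell m n c (int i + 1) (int j + 1)"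
    using assms by (auto simp: swap_cells_def)
  define b where "b = moves_left m n c (int i + 1) (int j + 1)"
  define x where "x = hop b (int i + 1)"
  have x: "1 \<le> x" "x \<le> int m" "cell m n (opposite m n c) (int m + 1 - x) (int n - int j)"
    "moves_left m n (opposite m n c) (int m + 1 - x) (int n - int j) = b"
    using cell_partner[of "int m" "int n" "int i + 1" c "int j + 1"] v m n
    by (simp_all add: x_def b_def)
  have p: "partner v = (nat (x - 1), j)" by (simp add: partner_def v x_def b_def)
  have nat: "int (nat (x - 1)) = x - 1" using x by simp
  show "partner v \<in> swapped_cells"
    using x v unfolding p swapped_cells_def by (simp add: nat algebra_simps nat_less_iff)
  \<comment> \<open>With the same flag \<open>b\<close>, the hop in rotated coordinates undoes the
    first one.\<close>
  have "int m - hop b (int m + 1 - x) = int i"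
    by (simp add: x_def hop_def)
  then show "partner_back (partner v) = v"
    using x unfolding p partner_back_def by (simp add: nat v algebra_simps)
  show "(v, partner v) \<in> parcs (path_graph m \<box> path_graph n)"
    using x v unfolding p by (auto simp: grid_arc_iff x_def hop_def split: if_splits)
qed

lemma partner_back_props:
  assumes "v \<in> swapped_cells"
  shows "partner_back v \<in> swap_cells" "partner (partner_back v) = v"
proof -
  let ?c = "opposite (int m) (int n) c"
  obtain i j where v: "v = (i, j)" "i < m" "j < n" "cell m n ?c (int m - int i) (int n - int j)"
    using assms by (auto simp: swapped_cells_def)
  define b where "b = moves_left m n ?c (int m - int i) (int n - int j)"
  define x where "x = hop b (int m - int i)"
  \<comment> \<open>\<open>cell_partner\<close> is used at the opposite parameter;
    \<open>opposite_opposite\<close> returns its conclusion to \<open>c\<close>.\<close>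
  have x: "1 \<le> x" "x \<le> int m" "cell m n c (int m + 1 - x) (int j + 1)"
    "moves_left m n c (int m + 1 - x) (int j + 1) = b"
    using cell_partner[of "int m" "int n" "int m - int i" ?c "int n - int j"] v m n
    by (simp_all add: x_def b_def algebra_simps)
  have p: "partner_back v = (nat (int m - x), j)" by (simp add: partner_back_def v x_def b_def)
  have nat: "int (nat (int m - x)) = int m - x" using x by simp
  show "partner_back v \<in> swap_cells"
    using x v unfolding p swap_cells_def by (simp add: nat algebra_simps nat_less_iff)
  have "hop b (int m + 1 - x) - 1 = int i"
    by (simp add: x_def hop_def)
  then show "partner (partner_back v) = v"
    using x unfolding p partner_def by (simp add: nat v algebra_simps)
qed

lemma swap_set_swap_cells: "swap_set (path_graph m \<box> path_graph n) swap_cells"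
proof -
  have "bij_betw partner swap_cells swapped_cells"
    by (rule bij_betw_byWitness[of _ partner_back]) (auto simp: partner_props partner_back_props)
  then show ?thesis
    unfolding swap_set_def
    using dominating_set_swap_cells dominating_set_swapped_cells swap_cells_disjoint partner_props(3)
      bij_betw_same_card by blast
qed

text \<open>The projected code covers all cells, so neither collisions nor the arbitrary values of
  dropped dominoes harm the upper bound.\<close>

lemma card_swap_cells_le: "card swap_cells \<le> card (perfect_code m n c)"
proof -
  have "swap_cells \<subseteq> (\<lambda>(x, y). (nat (x - 1), nat (y - 1))) ` project m n ` perfect_code m n c"
  proof
    fix v assume "v \<in> swap_cells"
    then obtain i j where v: "v = (i, j)" "i < m" "j < n" "cell m n c (int i + 1) (int j + 1)"
      by (auto simp: swap_cells_def)
    then have "(int i + 1, int j + 1) \<in> project m n ` perfect_code m n c"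
      using m n by (intro cell_in_project) auto
    then show "v \<in> (\<lambda>(x, y). (nat (x - 1), nat (y - 1))) ` project m n ` perfect_code m n c"
      by (rule rev_image_eqI) (simp add: v)
  qed
  then show ?thesis
    unfolding image_image by (rule surj_card_le[OF finite_perfect_code])
qed

end

theorem theorem31:
  fixes m n :: nat
  assumes "m \<ge> n" and "n \<ge> 8"
  shows "DD\<^sub>m (path_graph m \<box> path_graph n)
           \<le> enat (nat \<lfloor>(real n + 2) * (real m + 3) / 5\<rfloor>)"
proof -
  obtain c where c: "5 * card (perfect_code (int m) (int n) c) \<le> (n + 2) * (m + 3)"
    by (rule exists_small_perfect_code)
  have m: "8 \<le> m" using assms by simp
  have "DD\<^sub>m (path_graph m \<box> path_graph n) \<le> enat (card (swap_cells m n c))"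
    using DD\<^sub>m_le_card[OF swap_set_swap_cells[OF m assms(2)]] .
  also have "card (swap_cells m n c) \<le> nat \<lfloor>(real n + 2) * (real m + 3) / 5\<rfloor>"
  proof (rule le_nat_floor)
    have "5 * card (swap_cells m n c) \<le> (n + 2) * (m + 3)"
      using card_swap_cells_le[OF m assms(2), of c] c by linarith
    then have "real (5 * card (swap_cells m n c)) \<le> real ((n + 2) * (m + 3))"
      by (rule of_nat_mono)
    then show "real (card (swap_cells m n c)) \<le> (real n + 2) * (real m + 3) / 5"
      by (simp add: algebra_simps)
  qed
  finally show ?thesis by simp
qed

end
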